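(* Let $i \ge 0$ be an integer and let $n$ be an integer with $0<n<2^i$. Then $$f(n,i) = c(2^i-n).$$
   Context: For an integer $n$ and an integer $i\ge 0$, $f(n,i)$ denotes the number of binary signed-digit (BSD) representations of $n$ on $i$ bits, i.e. the number of tuples $(b_{i-1},\dots,b_0)\in\{1,0,-1\}^i$ with $n=\sum_{j=0}^{i-1} b_j 2^j$. Stern's diatomic sequence $c$ is defined on non-negative integers by $c(0)=0$, $c(1)=1$, $c(2m)=c(m)$, and $c(2m+1)=c(m)+c(m+1)$. *)

theory Defs
  imports Main
begin

(* A tuple (b_{i-1}, ..., b_0) is the list bs of length i with bs ! j = b_j,
   i.e. the least significant digit comes first. *)
definition bsd_reps :: "int \<Rightarrow> nat \<Rightarrow> int list set" where
  "bsd_reps n i = {bs. length bs = i \<and> set bs \<subseteq> {1, 0, -1} \<and> n = (\<Sum>j<i. bs ! j * 2 ^ j)}"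

lemma finite_bsd_reps: "finite (bsd_reps n i)"
  by (rule finite_subset[OF _ finite_lists_length_eq[of "{1, 0, -1}" i]])
    (auto simp: bsd_reps_def)

definition bsd_count :: "int \<Rightarrow> nat \<Rightarrow> nat" where
  "bsd_count n i = card (bsd_reps n i)"

(* The defining equations c(2m) = c(m) and c(2m+1) = c(m) + c(m+1) are not terminating
   as they stand (m = 0), so the recursion is set up by a case distinction;
   stern_double and stern_double_plus1 below recover them for all m. *)
function stern :: "nat \<Rightarrow> nat" where
  "stern n =
     (if n = 0 then 0
      else if n = 1 then 1
      else if even n then stern (n div 2)
      else stern (n div 2) + stern (n div 2 + 1))"
  by auto
termination
  by (relation "measure id") (auto elim!: oddE)

declare stern.simps [simp del]

lemma stern_0: "stern 0 = 0"
  by (simp add: stern.simps)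

lemma stern_1: "stern 1 = 1"
  by (simp add: stern.simps)

lemma stern_double: "stern (2 * m) = stern m"
  by (cases "m = 0") (simp_all add: stern.simps[of "2 * m"])

lemma stern_double_plus1: "stern (2 * m + 1) = stern m + stern (m + 1)"
proof (cases "m = 0")
  case True
  then show ?thesis by (simp add: stern_0)
next
  case False
  then show ?thesis by (simp add: stern.simps[of "2 * m + 1"] stern.simps[of "Suc (2 * m)"])
qed

end

(* The least significant digit of a representation has the parity of n, which gives
   f(2m, i+1) = f(m, i) and f(2m+1, i+1) = f(m, i) + f(m+1, i). The numbers c(2^i - n) satisfy
   the same recursion. The induction is over 0 \<le> n \<le> 2^i, since splitting an odd n reaches
   both end points. *)

theory Submission
  imports Defs
begin

text \<open>Horner's rule: the head of the list is the least significant digit, and removing it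
  leaves a representation of \<open>(n - b) / 2\<close>, so the division must be exact.\<close>

lemma Cons_in_bsd_reps_iff:
  "b # bs \<in> bsd_reps n (Suc i) \<longleftrightarrow>
     b \<in> {1, 0, -1} \<and> (\<exists>m. n = 2 * m + b \<and> bs \<in> bsd_reps m i)"
proof -
  have "(\<Sum>j<Suc i. (b # bs) ! j * 2 ^ j) = 2 * (\<Sum>j<i. bs ! j * 2 ^ j) + b"
    by (simp add: sum.lessThan_Suc_shift sum_distrib_left algebra_simps del: sum.lessThan_Suc)
  then show ?thesis
    unfolding bsd_reps_def by (auto simp del: sum.lessThan_Suc)
qed

lemma bsd_reps_Suc_cases:
  assumes "bs \<in> bsd_reps n (Suc i)"
  obtains b bs' where "bs = b # bs'"
  using assms by (cases bs) (auto simp: bsd_reps_def)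

lemma bsd_reps_double: "bsd_reps (2 * m) (Suc i) = Cons 0 ` bsd_reps m i"
proof (intro equalityI subsetI)
  fix bs assume bs: "bs \<in> bsd_reps (2 * m) (Suc i)"
  then obtain b bs' where [simp]: "bs = b # bs'" by (rule bsd_reps_Suc_cases)
  obtain k where k: "b \<in> {1, 0, -1}" "2 * m = 2 * k + b" "bs' \<in> bsd_reps k i"
    using bs by (auto simp: Cons_in_bsd_reps_iff)
  \<comment> \<open>Parity rules out the digits 1 and -1.\<close>
  then have "b = 0" "k = m" by (auto, presburger+)
  with k show "bs \<in> Cons 0 ` bsd_reps m i" by simp
qed (auto simp: Cons_in_bsd_reps_iff)

lemma bsd_reps_double_plus1:
  "bsd_reps (2 * m + 1) (Suc i) = Cons 1 ` bsd_reps m i \<union> Cons (-1) ` bsd_reps (m + 1) i"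
proof (intro equalityI subsetI)
  fix bs assume bs: "bs \<in> bsd_reps (2 * m + 1) (Suc i)"
  then obtain b bs' where [simp]: "bs = b # bs'" by (rule bsd_reps_Suc_cases)
  obtain k where k: "b \<in> {1, 0, -1}" "2 * m + 1 = 2 * k + b" "bs' \<in> bsd_reps k i"
    using bs by (auto simp: Cons_in_bsd_reps_iff)
  then have "b = 1 \<and> k = m \<or> b = -1 \<and> k = m + 1" by (auto, presburger+)
  with k show "bs \<in> Cons 1 ` bsd_reps m i \<union> Cons (-1) ` bsd_reps (m + 1) i" by auto
\<comment> \<open>The witness serves the digit -1: 2m + 1 = 2(m + 1) - 1.\<close>
qed (auto simp: Cons_in_bsd_reps_iff intro!: exI[of _ "m + 1"])

lemma bsd_count_double: "bsd_count (2 * m) (Suc i) = bsd_count m i"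
  by (simp add: bsd_count_def bsd_reps_double card_image)

lemma bsd_count_double_plus1:
  "bsd_count (2 * m + 1) (Suc i) = bsd_count m i + bsd_count (m + 1) i"
  unfolding bsd_count_def bsd_reps_double_plus1
  \<comment> \<open>The two images are disjoint because their lists start with different
    digits.\<close>
  by (subst card_Un_disjoint) (auto simp: finite_bsd_reps card_image)

lemma bsd_count_0_right: "bsd_count n 0 = (if n = 0 then 1 else 0)"
proof -
  have "bsd_reps n 0 = (if n = 0 then {[]} else {})"
    by (auto simp: bsd_reps_def)
  then show ?thesis by (simp add: bsd_count_def)
qed

lemma bsd_count_eq_stern:
  assumes "0 \<le> n" "n \<le> 2 ^ i"
  shows "bsd_count n i = stern (nat (2 ^ i - n))"
  using assms
proof (induction i arbitrary: n)
  case 0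
  \<comment> \<open>The empty tuple represents only 0, which matches c(1) = 1 for n = 0 and c(0) = 0
    for n = 1.\<close>
  then have "n = 0 \<or> n = 1" by auto
  then show ?case using stern_0 stern_1 by (auto simp: bsd_count_0_right)
next
  case (Suc i)
  show ?case
  proof (cases "even n")
    case True
    then obtain m where n: "n = 2 * m" by (elim evenE)
    have "nat (2 ^ Suc i - n) = 2 * nat (2 ^ i - m)" using n by simp
    then show ?thesis
      using Suc n by (simp add: bsd_count_double stern_double)
  next
    case False
    then obtain m where n: "n = 2 * m + 1" by (elim oddE)
    \<comment> \<open>Reflection at 2^i reverses order, so the smaller Stern argument
      \<open>k\<close> belongs to \<open>m + 1\<close> and the larger, \<open>k + 1\<close>, to
      \<open>m\<close>.\<close>
    define k where "k = nat (2 ^ i - (m + 1))"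
    \<comment> \<open>An odd \<open>n\<close> cannot equal the even number 2^(i+1), so
      \<open>m + 1\<close> stays within the range of the induction hypothesis and \<open>nat\<close>
      truncates nothing in \<open>k\<close>.\<close>
    have m: "0 \<le> m" "m + 1 \<le> 2 ^ i" using Suc.prems n by auto
    have k: "nat (2 ^ Suc i - n) = 2 * k + 1" "nat (2 ^ i - m) = k + 1"
      using m n by (auto simp: k_def)
    have "bsd_count n (Suc i) = bsd_count (m + 1) i + bsd_count m i"
      unfolding n bsd_count_double_plus1 by (rule add.commute)
    also have "\<dots> = stern k + stern (k + 1)"
      using Suc.IH[of m] Suc.IH[of "m + 1"] m k(2) by (simp add: k_def)
    also have "\<dots> = stern (nat (2 ^ Suc i - n))"
      by (simp only: k(1) stern_double_plus1)
    finally show ?thesis .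
  qed
qed

theorem theorem2:
  fixes n :: int and i :: nat
  assumes "0 < n" and "n < 2 ^ i"
  shows "bsd_count n i = stern (nat (2 ^ i - n))"
  using assms by (intro bsd_count_eq_stern) auto

end
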